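(* Let $S$ be a $p\times p$ positive semidefinite matrix with $\dim(\mathcal{N}(S))=m_0$, where $\mathcal{N}(S)=\{v\in\mathbb{R}^p: Sv=0\}$. Let $\mathrm{pen}_D=0$. If $$\liminf_{|x|\to\infty}\frac{\mathrm{pen}(x)}{\log|x|}>m_0,$$ then the penalised likelihood estimate $\hat\Theta_{\mathrm{Pen}}$ exists if and only if all diagonal entries of $S$ are strictly positive.
   Context: Fix an integer $p\ge 1$. All matrices are real symmetric $p\times p$; $\Theta=(\theta_{ij})\succ 0$ means $\Theta$ is positive definite. The off-diagonal penalty $\mathrm{pen}:\mathbb{R}\to\mathbb{R}$ is non-negative, symmetric around $0$, non-decreasing in $|x|$ and continuous, and $\mathrm{pen}_D:(0,\infty)\to\mathbb{R}$ denotes the diagonal penalty. Define $$\mathrm{Pen}(\Theta)=\sum_{i=1}^p \mathrm{pen}_D(\theta_{ii})+\sum_{i<j}\mathrm{pen}(\theta_{ij}),\qquad l_{\mathrm{Pen}}(\Theta\mid S)=\log\det\Theta-\mathrm{tr}(S\Theta)-\mathrm{Pen}(\Theta),\quad \Theta\succ 0.$$ The penalised likelihood estimate is $\hat\Theta_{\mathrm{Pen}}=\mathrm{argmax}_{\Theta\succ 0}\, l_{\mathrm{Pen}}(\Theta\mid S)$; it is said to exist if the supremum of $l_{\mathrm{Pen}}(\cdot\mid S)$ over positive definite $\Theta$ is finite and attained. *)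

theory Defs
  imports "HOL-Analysis.Analysis"
begin

definition symmetric_matrix :: "real^'n^'n \<Rightarrow> bool" where
  "symmetric_matrix A \<longleftrightarrow> transpose A = A"

definition pos_semidef :: "real^'n^'n \<Rightarrow> bool" where
  "pos_semidef A \<longleftrightarrow> symmetric_matrix A \<and> (\<forall>x. 0 \<le> x \<bullet> (A *v x))"

definition pos_def :: "real^'n^'n \<Rightarrow> bool" where
  "pos_def A \<longleftrightarrow> symmetric_matrix A \<and> (\<forall>x. x \<noteq> 0 \<longrightarrow> 0 < x \<bullet> (A *v x))"

definition null_space :: "real^'n^'m \<Rightarrow> (real^'n) set" where
  "null_space A = {v. A *v v = 0}"

definition offdiag_penalty :: "(real \<Rightarrow> real) \<Rightarrow> bool" where
  "offdiag_penalty pen \<longleftrightarrow>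
     (\<forall>x. 0 \<le> pen x) \<and> (\<forall>x. pen (- x) = pen x) \<and>
     (\<forall>x y. \<bar>x\<bar> \<le> \<bar>y\<bar> \<longrightarrow> pen x \<le> pen y) \<and> continuous_on UNIV pen"

text \<open>The matrix index type carries a linear order only so that the sum over \<open>i < j\<close> makes sense.
  The diagonal penalty is a function on \<open>(0, \<infinity>)\<close>; its values elsewhere are irrelevant because
  the diagonal entries of a positive definite matrix are positive.\<close>

definition Pen :: "(real \<Rightarrow> real) \<Rightarrow> (real \<Rightarrow> real) \<Rightarrow> real^('n::{finite,linorder})^('n::{finite,linorder}) \<Rightarrow> real" where
  "Pen penD pen \<Theta> =
     (\<Sum>i\<in>UNIV. penD (\<Theta> $ i $ i)) + (\<Sum>(i, j)\<in>{(i, j). i < j}. pen (\<Theta> $ i $ j))"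

definition l_Pen ::
    "(real \<Rightarrow> real) \<Rightarrow> (real \<Rightarrow> real) \<Rightarrow> real^('n::{finite,linorder})^('n::{finite,linorder}) \<Rightarrow> real^('n::{finite,linorder})^('n::{finite,linorder}) \<Rightarrow> real" where
  "l_Pen penD pen S \<Theta> = ln (det \<Theta>) - trace (S ** \<Theta>) - Pen penD pen \<Theta>"

text \<open>The supremum over the (nonempty) set of positive definite matrices is taken in the reals,
  so its finiteness is stated as boundedness from above.\<close>

definition penalised_estimate_exists ::
    "(real \<Rightarrow> real) \<Rightarrow> (real \<Rightarrow> real) \<Rightarrow> real^('n::{finite,linorder})^('n::{finite,linorder}) \<Rightarrow> bool" where
  "penalised_estimate_exists penD pen S \<longleftrightarrow>
     bdd_above (l_Pen penD pen S ` {\<Theta>. pos_def \<Theta>}) \<and>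
     (\<exists>\<Theta>\<^sub>0. pos_def \<Theta>\<^sub>0 \<and> l_Pen penD pen S \<Theta>\<^sub>0 = (SUP \<Theta>\<in>{\<Theta>. pos_def \<Theta>}. l_Pen penD pen S \<Theta>))"

end

theory Submission
  imports Defs
begin

text \<open>Write \<open>S\<close> as a sum of rank-one terms \<open>r r\<^sup>T\<close> and complete a basis of the span of the \<open>r\<close> by
  \<open>m\<^sub>0\<close> coordinate vectors. In this basis the diagonal of \<open>\<Theta>\<close> is bounded by \<open>\<tau> = tr (S \<Theta>)\<close>, respectively
  by \<open>tr \<Theta>\<close>, so a Hadamard-type inequality gives
  \<open>det \<Theta> \<le> D \<tau> ^ (p - m\<^sub>0) (tr \<Theta>) ^ m\<^sub>0\<close>. If \<open>S\<close> has a positive diagonal and \<open>tr \<Theta>\<close> is large, then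
  either \<open>\<tau>\<close> or some off-diagonal entry of \<open>\<Theta>\<close> is at least a fixed multiple of \<open>tr \<Theta>\<close>. In the first case
  \<open>-\<tau>\<close> beats the logarithms; in the second case the penalty, which grows like \<open>(m\<^sub>0 + e) log\<close>, beats
  \<open>m\<^sub>0 log (tr \<Theta>)\<close>. So superlevel sets are compact. Conversely, if \<open>S $ i $ i = 0\<close>, the diagonal matrices
  with a growing \<open>i\<close>-th entry make the likelihood unbounded.\<close>

section \<open>Quadratic forms and entries of positive semidefinite matrices\<close>

lemma inner_mult_vec_swap:
  fixes A :: "real^'n^'n"
  assumes "symmetric_matrix A"
  shows "x \<bullet> (A *v y) = y \<bullet> (A *v x)"
  using assms dot_lmul_matrix[of x A y]
  by (simp add: symmetric_matrix_def inner_commute flip: transpose_matrix_vector)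

lemma pos_def_imp_pos_semidef: "pos_def A \<Longrightarrow> pos_semidef A"
  unfolding pos_def_def pos_semidef_def by (metis inner_zero_left less_eq_real_def)

text \<open>The form evaluated at \<open>s x + t y\<close> is a nonnegative quadratic polynomial in
  \<open>s\<close> and \<open>t\<close>; two choices of the coefficients suffice.\<close>

lemma pos_semidef_Cauchy_Schwarz:
  fixes A :: "real^'n^'n"
  assumes "pos_semidef A"
  shows "(x \<bullet> (A *v y))\<^sup>2 \<le> (x \<bullet> (A *v x)) * (y \<bullet> (A *v y))"
proof -
  define a b c where "a = x \<bullet> (A *v x)" and "b = x \<bullet> (A *v y)" and "c = y \<bullet> (A *v y)"
  have sym: "symmetric_matrix A" and nn: "0 \<le> v \<bullet> (A *v v)" for v
    using assms by (auto simp: pos_semidef_def)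
  have quad: "0 \<le> s\<^sup>2 * a + 2 * s * t * b + t\<^sup>2 * c" for s t
  proof -
    have "(s *\<^sub>R x + t *\<^sub>R y) \<bullet> (A *v (s *\<^sub>R x + t *\<^sub>R y)) = s\<^sup>2 * a + 2 * s * t * b + t\<^sup>2 * c"
      using inner_mult_vec_swap[OF sym, of x y]
      by (simp add: a_def b_def c_def algebra_simps matrix_vector_right_distrib
          matrix_vector_mult_scaleR inner_add_left inner_add_right power2_eq_square)
    then show ?thesis using nn by metis
  qed
  have ac: "0 \<le> a" "0 \<le> c" using nn by (auto simp: a_def c_def)
  have "b\<^sup>2 \<le> a * c"
  proof (cases "c = 0")
    case True
    have "b = 0"
    proof (rule ccontr)
      assume "b \<noteq> 0"
      \<comment> \<open>With \<open>c = 0\<close> the polynomial is linear in \<open>t\<close>, and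
        this choice makes it \<open>a - (a + 1) = -1\<close>.\<close>
      then show False
        using quad[of 1 "- (a + 1) / (2 * b)"] True ac by (simp add: field_simps)
    qed
    then show ?thesis using True by simp
  next
    case False
    \<comment> \<open>The choice \<open>s = c\<close>, \<open>t = - b\<close> makes the polynomial
      factor in this way.\<close>
    then have "0 \<le> c * (a * c - b\<^sup>2)"
      using quad[of c "- b"] by (simp add: power2_eq_square algebra_simps)
    then show ?thesis using False ac by (simp add: zero_le_mult_iff)
  qed
  then show ?thesis by (simp add: a_def b_def c_def)
qed

text \<open>Cauchy-Schwarz against the vector \<open>A *v v\<close> itself bounds the fourth power
  of its norm by zero.\<close>

lemma pos_semidef_mult_eq_0:
  fixes A :: "real^'n^'n"
  assumes "pos_semidef A" "v \<bullet> (A *v v) = 0"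
  shows "A *v v = 0"
  using pos_semidef_Cauchy_Schwarz[OF assms(1), of "A *v v" v] assms(2) by simp

lemma quadratic_form_axis: "axis i 1 \<bullet> ((A :: real^'n^'n) *v axis j 1) = A $ i $ j"
  by (simp add: inner_axis' matrix_vector_mult_basis column_def)

lemma pos_semidef_diag_nonneg: "pos_semidef A \<Longrightarrow> 0 \<le> A $ i $ i"
  by (metis pos_semidef_def quadratic_form_axis)

lemma pos_def_diag_pos: "pos_def A \<Longrightarrow> 0 < A $ i $ i"
  by (metis pos_def_def quadratic_form_axis axis_eq_0_iff zero_neq_one)

lemma pos_semidef_entry_bound:
  fixes A :: "real^'n^'n"
  assumes "pos_semidef A"
  shows "\<bar>A $ i $ j\<bar> \<le> sqrt (A $ i $ i) * sqrt (A $ j $ j)"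
  using pos_semidef_Cauchy_Schwarz[OF assms, of "axis i 1" "axis j 1"]
  by (simp add: quadratic_form_axis real_le_rsqrt flip: real_sqrt_mult real_sqrt_abs)

lemma diag_le_trace:
  assumes "pos_semidef A"
  shows "A $ i $ i \<le> trace A"
  unfolding trace_def by (rule member_le_sum) (auto simp: pos_semidef_diag_nonneg[OF assms])

lemma pos_semidef_entry_le_trace:
  assumes "pos_semidef A"
  shows "\<bar>A $ i $ j\<bar> \<le> trace A"
proof -
  have "sqrt (A $ i $ i) * sqrt (A $ j $ j) \<le> sqrt (trace A) * sqrt (trace A)"
    by (intro mult_mono) (use assms diag_le_trace order_trans[OF pos_semidef_diag_nonneg diag_le_trace] pos_semidef_diag_nonneg in auto)
  then show ?thesis
    using pos_semidef_entry_bound[OF assms, of i j] order_trans[OF pos_semidef_diag_nonneg[OF assms] diag_le_trace[OF assms, of i]]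
    by simp
qed

section \<open>Determinant bounds\<close>

text \<open>Hadamard's inequality holds without the factorial; this weak form needs no spectral theory.\<close>

lemma pos_semidef_det_le_prod_diag:
  fixes A :: "real^'n^'n"
  assumes "pos_semidef A"
  shows "det A \<le> fact CARD('n) * (\<Prod>i\<in>UNIV. A $ i $ i)"
proof -
  have term_le: "of_int (sign \<pi>) * (\<Prod>i\<in>UNIV. A $ i $ \<pi> i) \<le> (\<Prod>i\<in>UNIV. A $ i $ i)"
    if "\<pi> permutes UNIV" for \<pi>
  proof -
    have "of_int (sign \<pi>) * (\<Prod>i\<in>UNIV. A $ i $ \<pi> i) \<le> \<bar>\<Prod>i\<in>UNIV. A $ i $ \<pi> i\<bar>"
      by (auto simp: sign_def)
    also have "\<dots> \<le> (\<Prod>i\<in>UNIV. sqrt (A $ i $ i) * sqrt (A $ \<pi> i $ \<pi> i))"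
      unfolding abs_prod by (rule prod_mono) (use pos_semidef_entry_bound[OF assms] in auto)
    \<comment> \<open>A permutation meets every index once as a row and once as a column, so the
      bound is the same for all \<open>fact CARD('n)\<close> terms.\<close>
    also have "\<dots> = (\<Prod>i\<in>UNIV. sqrt (A $ i $ i)) * (\<Prod>i\<in>UNIV. sqrt (A $ i $ i))"
      using prod.permute[OF that, of "\<lambda>i. sqrt (A $ i $ i)"] by (simp add: prod.distrib o_def)
    also have "\<dots> = (\<Prod>i\<in>UNIV. A $ i $ i)"
      by (simp add: pos_semidef_diag_nonneg[OF assms] flip: prod.distrib)
    finally show ?thesis .
  qed
  have "det A \<le> (\<Sum>\<pi>\<in>{\<pi>. \<pi> permutes (UNIV :: 'n set)}. (\<Prod>i\<in>UNIV. A $ i $ i))"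
    unfolding det_def by (rule sum_mono) (use term_le in auto)
  then show ?thesis by (simp add: card_permutations)
qed

lemma matrix_gram_eq:
  fixes A :: "real^'n^'n" and q :: "'n \<Rightarrow> real^'n"
  defines "Q \<equiv> (\<chi> i. q i)"
  shows "(\<chi> i j. q i \<bullet> (A *v q j)) = Q ** A ** transpose Q"
proof -
  have "q i \<bullet> (A *v q j) = (\<Sum>k\<in>UNIV. (\<Sum>l\<in>UNIV. q i $ l * A $ l $ k) * q j $ k)" for i j
    unfolding dot_lmul_matrix[symmetric]
    by (simp add: inner_vec_def vector_matrix_mult_def mult.commute)
  then show ?thesis
    by (simp add: Q_def vec_eq_iff matrix_matrix_mult_def transpose_def)
qed

text \<open>The weak Hadamard inequality is applied to the matrix of the form in the vectors
  \<open>q i\<close>, which is \<open>Q ** A ** transpose Q\<close>. This transfers the diagonal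
  bound from coordinate vectors to any basis.\<close>

lemma det_gram_bound:
  fixes A :: "real^'n^'n" and q :: "'n \<Rightarrow> real^'n"
  assumes "pos_semidef A"
  shows "(det (\<chi> i. q i))\<^sup>2 * det A \<le> fact CARD('n) * (\<Prod>i\<in>UNIV. q i \<bullet> (A *v q i))"
proof -
  define Q :: "real^'n^'n" where "Q = (\<chi> i. q i)"
  define M where "M = (\<chi> i j. q i \<bullet> (A *v q j))"
  have M: "M = Q ** A ** transpose Q"
    by (simp add: M_def Q_def matrix_gram_eq)
  have sym: "symmetric_matrix A" using assms by (simp add: pos_semidef_def)
  have "pos_semidef M"
    unfolding pos_semidef_def
  proof (intro conjI allI)
    show "symmetric_matrix M"
      using inner_mult_vec_swap[OF sym]
      by (simp add: M_def symmetric_matrix_def transpose_def vec_eq_iff)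
    fix x
    have "x \<bullet> (M *v x) = (transpose Q *v x) \<bullet> (A *v (transpose Q *v x))"
      unfolding M transpose_matrix_vector dot_lmul_matrix
      by (simp add: matrix_vector_mul_assoc matrix_mul_assoc flip: transpose_matrix_vector)
    then show "0 \<le> x \<bullet> (M *v x)" using assms by (simp add: pos_semidef_def)
  qed
  from pos_semidef_det_le_prod_diag[OF this]
  show ?thesis
    by (simp add: M det_mul power2_eq_square mult_ac Q_def[symmetric]) (simp add: M[symmetric] M_def)
qed

text \<open>Peeling off rank-one terms: \<open>A - w w\<^sup>T / (v \<bullet> w)\<close> with \<open>w = A v\<close> is positive semidefinite
  with \<open>v\<close> as an additional null vector.\<close>

lemma pos_semidef_rank_one_decomposition:
  fixes A :: "real^'n^'n"
  assumes "pos_semidef A"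
  obtains n :: nat and r where "\<And>i j. A $ i $ j = (\<Sum>k<n. r k $ i * r k $ j)"
proof -
  have "\<exists>rs. \<forall>i j. A $ i $ j = (\<Sum>r\<leftarrow>rs. r $ i * r $ j)"
    using assms
  \<comment> \<open>The measure is the rank of \<open>A\<close>; each peeled term lowers it.\<close>
  proof (induction "CARD('n) - dim (null_space A)" arbitrary: A rule: less_induct)
    case less
    show ?case
    proof (cases "A = 0")
      case True
      then show ?thesis by (intro exI[of _ "[]"]) simp
    next
      case False
      then obtain v where v: "A *v v \<noteq> 0"
        by (metis matrix_vector_mult_0 matrix_eq)
      have sym: "symmetric_matrix A" using less.prems by (simp add: pos_semidef_def)
      define c where "c = v \<bullet> (A *v v)"
      have "c > 0"
        using v less.prems pos_semidef_mult_eq_0[OF less.prems, of v]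
        by (auto simp: c_def pos_semidef_def order_less_le)
      define r where "r = (1 / sqrt c) *\<^sub>R (A *v v)"
      define A' :: "real^'n^'n" where "A' = (\<chi> i j. A $ i $ j - r $ i * r $ j)"
      have A'v: "A' *v x = A *v x - (r \<bullet> x) *\<^sub>R r" for x
        by (simp add: A'_def vec_eq_iff matrix_vector_mult_def inner_vec_def algebra_simps
            sum_subtractf sum_distrib_left)
      have rx: "r \<bullet> x = (v \<bullet> (A *v x)) / sqrt c" for x
        using inner_mult_vec_swap[OF sym, of v x] by (simp add: r_def inner_commute)
      have psd': "pos_semidef A'"
        unfolding pos_semidef_def
      proof (intro conjI allI)
        show "symmetric_matrix A'"
          using sym by (simp add: symmetric_matrix_def A'_def transpose_def vec_eq_iff mult.commute)
        fix x
        \<comment> \<open>This is Cauchy-Schwarz for \<open>v\<close> and \<open>x\<close>, divided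
          by \<open>c\<close>.\<close>
        have "(r \<bullet> x)\<^sup>2 \<le> x \<bullet> (A *v x)"
          using pos_semidef_Cauchy_Schwarz[OF less.prems, of v x] \<open>c > 0\<close>
          unfolding rx by (simp add: power_divide divide_simps c_def[symmetric] mult.commute)
        then show "0 \<le> x \<bullet> (A' *v x)"
          by (simp add: A'v inner_diff_right inner_commute power2_eq_square)
      qed
      \<comment> \<open>The old null space survives because \<open>r \<bullet> x\<close> is a
        multiple of \<open>v \<bullet> (A *v x)\<close>, and \<open>v\<close> is new in it, so the
        dimension strictly grows.\<close>
      have v0: "v \<in> null_space A'"
        using \<open>c > 0\<close> rx[of v] by (simp add: null_space_def A'v r_def c_def[symmetric])
      have sub: "null_space A \<subseteq> null_space A'"
        by (auto simp: null_space_def A'v rx)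
      have subsp: "subspace (null_space B)" for B :: "real^'n^'n"
        by (auto simp: null_space_def subspace_def matrix_vector_right_distrib matrix_vector_mult_scaleR)
      have "v \<notin> null_space A" using v by (simp add: null_space_def)
      then have "dim (null_space A) < dim (null_space A')"
        using dim_psubset[of "null_space A" "null_space A'"] sub v0 subsp
        unfolding span_eq_iff[THEN iffD2, OF subsp] by blast
      moreover have "dim (null_space A') \<le> CARD('n)"
        using dim_subset_UNIV_cart[of "null_space A'"] by (simp add: dim_vec_eq)
      ultimately obtain rs where "\<forall>i j. A' $ i $ j = (\<Sum>r\<leftarrow>rs. r $ i * r $ j)"
        using less.hyps[OF _ psd'] by (meson diff_less_mono2 order_less_le_trans)
      then show ?thesis
        by (intro exI[of _ "r # rs"]) (simp add: A'_def algebra_simps)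
    qed
  qed
  then obtain rs where "\<And>i j. A $ i $ j = (\<Sum>r\<leftarrow>rs. r $ i * r $ j)" by blast
  then show ?thesis
    by (intro that[of "\<lambda>k. rs ! k" "length rs"]) (simp add: sum_list_sum_nth atLeast0LessThan)
qed

lemma rank_one_sum_mult_vec:
  fixes S :: "real^'n^'n" and n :: nat
  assumes "\<And>i j. S $ i $ j = (\<Sum>k<n. r k $ i * r k $ j)"
  shows "S *v x = (\<Sum>k<n. (r k \<bullet> x) *\<^sub>R r k)"
proof -
  have "(\<Sum>j\<in>UNIV. (\<Sum>k<n. r k $ i * r k $ j) * x $ j) = (\<Sum>k<n. (r k \<bullet> x) * r k $ i)" for i
    unfolding sum_distrib_right inner_vec_def by (subst sum.swap) (simp add: mult_ac)
  then show ?thesis by (simp add: vec_eq_iff matrix_vector_mult_def assms)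
qed

text \<open>For positive semidefinite \<open>\<Theta>\<close> all summands on the right are
  nonnegative, so each single form \<open>r k \<bullet> (\<Theta> *v r k)\<close> is at most the
  trace.\<close>

lemma rank_one_sum_trace:
  fixes S :: "real^'n^'n" and n :: nat
  assumes "\<And>i j. S $ i $ j = (\<Sum>k<n. r k $ i * r k $ j)"
  shows "trace (S ** \<Theta>) = (\<Sum>k<n. r k \<bullet> (\<Theta> *v r k))"
proof -
  have "trace (S ** \<Theta>) = (\<Sum>i\<in>UNIV. \<Sum>j\<in>UNIV. \<Sum>k<n. r k $ i * r k $ j * \<Theta> $ j $ i)"
    by (simp add: trace_def matrix_matrix_mult_def assms sum_distrib_right)
  also have "\<dots> = (\<Sum>j\<in>UNIV. \<Sum>i\<in>UNIV. \<Sum>k<n. r k $ i * r k $ j * \<Theta> $ j $ i)"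
    by (rule sum.swap)
  also have "\<dots> = (\<Sum>j\<in>UNIV. \<Sum>k<n. \<Sum>i\<in>UNIV. r k $ i * r k $ j * \<Theta> $ j $ i)"
    by (intro sum.cong refl sum.swap)
  also have "\<dots> = (\<Sum>k<n. \<Sum>j\<in>UNIV. \<Sum>i\<in>UNIV. r k $ i * r k $ j * \<Theta> $ j $ i)"
    by (rule sum.swap)
  also have "\<dots> = (\<Sum>k<n. r k \<bullet> (\<Theta> *v r k))"
    by (simp add: inner_vec_def matrix_vector_mult_def sum_distrib_left mult_ac)
  finally show ?thesis .
qed

lemma det_pos_semidef_bound:
  fixes S :: "real^'n^'n"
  assumes "pos_semidef S"
  obtains D where "0 < D"
    and "\<And>\<Theta>. pos_semidef \<Theta> \<Longrightarrow>
      det \<Theta> \<le> D * trace (S ** \<Theta>) ^ (CARD('n) - dim (null_space S)) * trace \<Theta> ^ dim (null_space S)"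
    and "\<And>\<Theta>. pos_semidef \<Theta> \<Longrightarrow> 0 \<le> trace (S ** \<Theta>)"
proof -
  define m where "m = dim (null_space S)"
  obtain r and n :: nat where r: "\<And>i j. S $ i $ j = (\<Sum>k<n. r k $ i * r k $ j)"
    using pos_semidef_rank_one_decomposition[OF assms] by metis
  note mult = rank_one_sum_mult_vec[OF r] and tr = rank_one_sum_trace[OF r]
  have tr_nonneg: "0 \<le> trace (S ** \<Theta>)" if "pos_semidef \<Theta>" for \<Theta>
    using that by (auto simp: tr pos_semidef_def intro!: sum_nonneg)
  have r_le_tr: "r k \<bullet> (\<Theta> *v r k) \<le> trace (S ** \<Theta>)" if "pos_semidef \<Theta>" "k < n" for \<Theta> k
    unfolding tr using that by (intro member_le_sum) (auto simp: pos_semidef_def)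
  let ?R = "r ` {..<n}"
  \<comment> \<open>The null space is the orthogonal complement of the span of the
    \<open>r k\<close>, so that span has dimension \<open>CARD('n) - m\<close>.\<close>
  have "null_space S = {y \<in> UNIV. \<forall>x\<in>span ?R. orthogonal x y}"
  proof (intro set_eqI iffI)
    fix y assume "y \<in> null_space S"
    then have "(\<Sum>k<n. (r k \<bullet> y)\<^sup>2) = 0"
      using arg_cong[OF mult[of y], of "(\<bullet>) y"]
      by (simp add: null_space_def inner_sum_right power2_eq_square inner_commute)
    then have "\<forall>k<n. r k \<bullet> y = 0" by (simp add: sum_nonneg_eq_0_iff)
    then have "\<forall>x\<in>?R. orthogonal y x" by (auto simp: orthogonal_def inner_commute)
    then show "y \<in> {y \<in> UNIV. \<forall>x\<in>span ?R. orthogonal x y}"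
      using orthogonal_to_span orthogonal_commute by blast
  next
    fix y assume "y \<in> {y \<in> UNIV. \<forall>x\<in>span ?R. orthogonal x y}"
    then have "r k \<bullet> y = 0" if "k < n" for k
      using that span_base[of "r k" ?R] by (auto simp: orthogonal_def)
    then show "y \<in> null_space S" by (simp add: null_space_def mult)
  qed
  then have dimR: "m + dim ?R = CARD('n)"
    using dim_subspace_orthogonal_to_vectors[of "span ?R" "UNIV :: (real^'n) set"]
    by (simp add: m_def dim_span)
  obtain J where J: "J \<subseteq> ?R" "independent J" "?R \<subseteq> span J" "card J = dim ?R"
    by (rule basis_exists[of ?R])
  let ?axes = "range (\<lambda>i :: 'n. axis i 1 :: real^'n)"
  have span_axes: "span ?axes = UNIV"
  proof -
    have "(Basis :: (real^'n) set) = ?axes" by (auto simp: Basis_vec_def)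
    then show ?thesis using span_Basis by metis
  qed
  \<comment> \<open>The basis \<open>J\<close> is completed by coordinate vectors only: their forms
    are diagonal entries of \<open>\<Theta>\<close>, hence at most
    \<open>trace \<Theta>\<close>.\<close>
  obtain B where B: "J \<subseteq> B" "B \<subseteq> J \<union> ?axes" "independent B" "J \<union> ?axes \<subseteq> span B"
    by (rule maximal_independent_subset_extend[of J "J \<union> ?axes"]) (use J(2) in auto)
  have spanB: "span B = UNIV"
    using span_mono[of ?axes "span B"] B(4) span_axes by (simp add: span_span top.extremum_uniqueI)
  have finB: "finite B" using B(3) by (rule independent_imp_finite)
  have cardB: "card B = CARD('n)"
    using dim_eq_card[of B UNIV] B(3) spanB by (simp add: dim_vec_eq)
  then obtain q where q: "bij_betw q (UNIV :: 'n set) B"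
    using finite_same_card_bij[of "UNIV :: 'n set" B] finB by auto
  define Q :: "real^'n^'n" where "Q = (\<chi> i. q i)"
  have "rows Q = B"
    using q by (auto simp: rows_def row_def Q_def bij_betw_def)
  then have "rank Q = CARD('n)"
    using dim_span[of B] spanB by (simp add: row_rank_def)
  then have detQ: "det Q \<noteq> 0" by (simp add: det_eq_0_rank)
  have cardJ: "card J = CARD('n) - m" "card (B - J) = m"
    using dimR J(4) cardB card_Diff_subset[OF finite_subset[OF B(1) finB] B(1)] by auto
  \<comment> \<open>The factor comes from \<open>det_gram_bound\<close>; the basis was chosen from
    \<open>S\<close> alone, so \<open>D\<close> is uniform in \<open>\<Theta>\<close>.\<close>
  define D where "D = fact CARD('n) / (det Q)\<^sup>2"
  show ?thesis
  proof
    show "0 < D" using detQ by (simp add: D_def)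
    fix \<Theta> :: "real^'n^'n" assume psd: "pos_semidef \<Theta>"
    show "0 \<le> trace (S ** \<Theta>)" using psd by (rule tr_nonneg)
    have nn: "0 \<le> b \<bullet> (\<Theta> *v b)" for b using psd by (simp add: pos_semidef_def)
    have "(\<Prod>i\<in>UNIV. q i \<bullet> (\<Theta> *v q i)) = (\<Prod>b\<in>B. b \<bullet> (\<Theta> *v b))"
      using prod.reindex_bij_betw[OF q, of "\<lambda>b. b \<bullet> (\<Theta> *v b)"] .
    also have "\<dots> = (\<Prod>b\<in>J. b \<bullet> (\<Theta> *v b)) * (\<Prod>b\<in>B - J. b \<bullet> (\<Theta> *v b))"
      using prod.subset_diff[OF B(1) finB] by (simp add: mult.commute)
    also have "\<dots> \<le> (\<Prod>b\<in>J. trace (S ** \<Theta>)) * (\<Prod>b\<in>B - J. trace \<Theta>)"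
    proof (intro mult_mono prod_mono prod_nonneg ballI conjI nn tr_nonneg[OF psd])
      fix b assume "b \<in> J"
      then show "b \<bullet> (\<Theta> *v b) \<le> trace (S ** \<Theta>)" using J(1) r_le_tr[OF psd] by auto
    next
      fix b assume "b \<in> B - J"
      then show "b \<bullet> (\<Theta> *v b) \<le> trace \<Theta>"
        using B(2) diag_le_trace[OF psd] by (auto simp: quadratic_form_axis)
    qed
    finally have "(\<Prod>i\<in>UNIV. q i \<bullet> (\<Theta> *v q i)) \<le> trace (S ** \<Theta>) ^ (CARD('n) - m) * trace \<Theta> ^ m"
      by (simp add: cardJ)
    then have "(det Q)\<^sup>2 * det \<Theta> \<le> fact CARD('n) * (trace (S ** \<Theta>) ^ (CARD('n) - m) * trace \<Theta> ^ m)"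
      using det_gram_bound[OF psd, of q] unfolding Q_def[symmetric]
      by (meson fact_ge_zero mult_left_mono order_trans)
    then show "det \<Theta> \<le> D * trace (S ** \<Theta>) ^ (CARD('n) - dim (null_space S)) * trace \<Theta> ^ dim (null_space S)"
      using detQ by (simp add: D_def m_def field_simps)
  qed
qed

section \<open>Positive definiteness and the determinant\<close>

lemma pos_def_mat_1: "pos_def (mat 1 :: real^'n^'n)"
  by (simp add: pos_def_def symmetric_matrix_def)

lemma continuous_on_det [continuous_intros]:
  fixes f :: "'a::topological_space \<Rightarrow> real^'n^'n"
  assumes "continuous_on A f"
  shows "continuous_on A (\<lambda>x. det (f x))"
  unfolding det_def by (intro continuous_intros assms)

lemma pos_def_det_nonzero:
  assumes "pos_def A"
  shows "det A \<noteq> 0"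
proof
  assume "det A = 0"
  then have "\<not> inj ((*v) A)"
    using det_nz_iff_inj[of "(*v) A"] by simp
  then obtain x where "x \<noteq> 0" "A *v x = 0"
    by (auto simp: linear_injective_0)
  then show False using assms by (auto simp: pos_def_def)
qed

text \<open>The segment from the identity to \<open>A\<close> consists of positive definite matrices, so \<open>det\<close> has no
  zero on it.\<close>

lemma pos_def_det_pos:
  fixes A :: "real^'n^'n"
  assumes "pos_def A"
  shows "0 < det A"
proof (rule ccontr)
  assume "\<not> 0 < det A"
  define f where "f t = (1 - t) *\<^sub>R mat 1 + t *\<^sub>R A" for t :: real
  have "continuous_on {0..1} (\<lambda>t. det (f t))"
    unfolding f_def by (intro continuous_intros)
  moreover have "det (f 1) \<le> 0" "0 \<le> det (f 0)"
    using \<open>\<not> 0 < det A\<close> by (simp_all add: f_def)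
  ultimately obtain t where t: "0 \<le> t" "t \<le> 1" "det (f t) = 0"
    using IVT2'[of "\<lambda>t. det (f t)" 1 0 0] by auto
  have "pos_def (f t)"
    unfolding pos_def_def
  proof (intro conjI allI impI)
    show "symmetric_matrix (f t)"
      using assms by (auto simp: pos_def_def symmetric_matrix_def f_def transpose_def mat_def vec_eq_iff)
    fix x :: "real^'n" assume "x \<noteq> 0"
    then have "0 < x \<bullet> x" "0 < x \<bullet> (A *v x)" using assms by (auto simp: pos_def_def)
    moreover have "x \<bullet> (f t *v x) = (1 - t) * (x \<bullet> x) + t * (x \<bullet> (A *v x))"
      by (simp add: f_def matrix_vector_mult_add_rdistrib inner_add_right flip: scaleR_matrix_vector_assoc)
    ultimately show "0 < x \<bullet> (f t *v x)"
      using t(1,2) by (cases "t = 0") (auto intro: add_nonneg_pos)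
  qed
  then show False using pos_def_det_nonzero t(3) by blast
qed

text \<open>This is how a closed set of semidefinite matrices with determinant bounded away from
  zero is seen to lie inside the positive definite ones.\<close>

lemma pos_semidef_det_nonzero_imp_pos_def:
  assumes "pos_semidef A" "det A \<noteq> 0"
  shows "pos_def A"
  unfolding pos_def_def
proof (intro conjI allI impI)
  show "symmetric_matrix A" using assms by (simp add: pos_semidef_def)
  fix x :: "real^'a" assume "x \<noteq> 0"
  have "inj ((*v) A)" using assms(2) det_nz_iff_inj[of "(*v) A"] by simp
  then have "A *v x \<noteq> 0" using \<open>x \<noteq> 0\<close> by (auto simp: linear_injective_0)
  then show "0 < x \<bullet> (A *v x)"
    using pos_semidef_mult_eq_0[OF assms(1), of x] assms(1) by (auto simp: pos_semidef_def order_less_le)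
qed

section \<open>Growth estimates for the logarithm, the penalty and the trace\<close>

lemma ln_le_linear:
  fixes k e :: real
  assumes "0 \<le> k" "0 < e"
  obtains C where "\<And>x. 0 < x \<Longrightarrow> k * ln x \<le> e * x + C"
proof (cases "k = 0")
  case True
  with assms show ?thesis by (intro that[of 0]) simp
next
  case False
  with assms have "k > 0" by simp
  show ?thesis
  proof (rule that)
    fix x :: real assume "0 < x"
    \<comment> \<open>Rescaling before using \<open>ln y \<le> y\<close> turns the slope into
      \<open>e\<close>, at the cost of the constant \<open>k * ln (k / e)\<close>.\<close>
    then have "ln x = ln (e * x / k) + ln (k / e)"
      using \<open>k > 0\<close> \<open>0 < e\<close> by (simp add: ln_mult ln_div)
    also have "\<dots> \<le> e * x / k + ln (k / e)"
      using ln_bound[of "e * x / k"] \<open>0 < x\<close> \<open>k > 0\<close> \<open>0 < e\<close> by simp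
    finally have "k * ln x \<le> k * (e * x / k + ln (k / e))"
      using \<open>k > 0\<close> by (intro mult_left_mono) simp_all
    then show "k * ln x \<le> e * x + k * ln (k / e)"
      using \<open>k > 0\<close> by (simp add: algebra_simps)
  qed
qed

text \<open>A slope \<open>c\<close> strictly between \<open>m\<close> and the limit inferior works
  for large arguments; for the others nonnegativity of \<open>pen\<close> and the constant
  \<open>c * ln R\<close> suffice.\<close>

lemma offdiag_penalty_log_lower_bound:
  fixes m :: real
  assumes "offdiag_penalty pen" "0 \<le> m"
    and "ereal m < Liminf at_infinity (\<lambda>x. ereal (pen x / ln \<bar>x\<bar>))"
  obtains e C where "0 < e" "\<And>x. x \<noteq> 0 \<Longrightarrow> (m + e) * ln \<bar>x\<bar> - C \<le> pen x"
proof -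
  obtain c where c: "m < c" "ereal c < Liminf at_infinity (\<lambda>x. ereal (pen x / ln \<bar>x\<bar>))"
    using ereal_dense2[OF assms(3)] by auto
  obtain b where b: "\<And>x. b \<le> \<bar>x\<bar> \<Longrightarrow> c < pen x / ln \<bar>x\<bar>"
    using less_LiminfD[OF c(2)] by (auto simp: eventually_at_infinity)
  \<comment> \<open>A threshold of at least 2 makes \<open>ln \<bar>x\<bar>\<close> positive, so the
    quotient can be cleared.\<close>
  define R where "R = max b 2"
  have "c * ln \<bar>x\<bar> - c * ln R \<le> pen x" if "x \<noteq> 0" for x
  proof (cases "R \<le> \<bar>x\<bar>")
    case True
    then have "0 < ln \<bar>x\<bar>" "c < pen x / ln \<bar>x\<bar>" using b by (auto simp: R_def)
    then have "c * ln \<bar>x\<bar> \<le> pen x" by (simp add: field_simps)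
    moreover have "0 \<le> c * ln R" using c(1) assms(2) by (simp add: R_def)
    ultimately show ?thesis by linarith
  next
    case False
    then have "c * ln \<bar>x\<bar> \<le> c * ln R" using that c(1) assms(2) by (intro mult_left_mono) auto
    moreover have "0 \<le> pen x" using assms(1) by (simp add: offdiag_penalty_def)
    ultimately show ?thesis by linarith
  qed
  then show ?thesis using c(1) by (intro that[of "c - m" "c * ln R"]) auto
qed

text \<open>Read contrapositively: if \<open>trace (S ** \<Theta>)\<close> is small relative to
  \<open>trace \<Theta>\<close>, some off-diagonal entry of \<open>\<Theta>\<close> must be
  large.\<close>

lemma trace_mult_lower_bound:
  fixes S \<Theta> :: "real^'n^'n"
  assumes "\<And>i. s \<le> S $ i $ i" "\<And>i. 0 \<le> \<Theta> $ i $ i"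
    and "\<And>i j. i \<noteq> j \<Longrightarrow> \<bar>\<Theta> $ i $ j\<bar> \<le> \<mu>" "0 \<le> \<mu>"
  shows "s * trace \<Theta> - (\<Sum>i\<in>UNIV. \<Sum>j\<in>UNIV. \<bar>S $ i $ j\<bar>) * \<mu> \<le> trace (S ** \<Theta>)"
proof -
  \<comment> \<open>Subtracting \<open>\<bar>S $ i $ i\<bar> * \<mu>\<close> on the diagonal too
    only weakens the bound and lets the sum run over all pairs.\<close>
  have entry: "(if j = i then s * \<Theta> $ i $ i else 0) - \<bar>S $ i $ j\<bar> * \<mu> \<le> S $ i $ j * \<Theta> $ j $ i" for i j
  proof (cases "j = i")
    case True
    have "s * \<Theta> $ i $ i \<le> S $ i $ i * \<Theta> $ i $ i" using assms(1,2) by (intro mult_right_mono) auto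
    moreover have "0 \<le> \<bar>S $ i $ j\<bar> * \<mu>" using assms(4) by simp
    ultimately show ?thesis using True by simp
  next
    case False
    have "- (S $ i $ j * \<Theta> $ j $ i) \<le> \<bar>S $ i $ j\<bar> * \<bar>\<Theta> $ j $ i\<bar>"
      by (simp add: abs_le_D2 flip: abs_mult)
    also have "\<dots> \<le> \<bar>S $ i $ j\<bar> * \<mu>" using False assms(3) by (intro mult_left_mono) auto
    finally show ?thesis using False by simp
  qed
  have "s * trace \<Theta> - (\<Sum>i\<in>UNIV. \<Sum>j\<in>UNIV. \<bar>S $ i $ j\<bar>) * \<mu>
      = (\<Sum>i\<in>UNIV. \<Sum>j\<in>UNIV. (if j = i then s * \<Theta> $ i $ i else 0) - \<bar>S $ i $ j\<bar> * \<mu>)"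
    by (simp add: trace_def sum_subtractf sum_distrib_left sum_distrib_right)
  also have "\<dots> \<le> (\<Sum>i\<in>UNIV. \<Sum>j\<in>UNIV. S $ i $ j * \<Theta> $ j $ i)"
    by (intro sum_mono entry)
  finally show ?thesis by (simp add: trace_def matrix_matrix_mult_def)
qed

section \<open>Coercivity of the penalised likelihood\<close>

lemma Pen_nonneg:
  assumes "offdiag_penalty pen"
  shows "0 \<le> Pen (\<lambda>_. 0) pen \<Theta>"
  using assms by (auto simp: Pen_def offdiag_penalty_def intro!: sum_nonneg)

lemma offdiag_penalty_le_Pen:
  assumes "offdiag_penalty pen" "symmetric_matrix \<Theta>" "i \<noteq> j"
  shows "pen (\<Theta> $ i $ j) \<le> Pen (\<lambda>_. 0) pen \<Theta>"
proof -
  have le: "pen (\<Theta> $ k $ l) \<le> Pen (\<lambda>_. 0) pen \<Theta>" if "k < l" for k l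
    using member_le_sum[of "(k, l)" "{(i, j). i < j}" "\<lambda>(i, j). pen (\<Theta> $ i $ j)"] that assms(1)
    by (auto simp: Pen_def offdiag_penalty_def)
  have "\<Theta> $ i $ j = \<Theta> $ j $ i"
    using assms(2) unfolding symmetric_matrix_def transpose_def by (metis vec_lambda_beta)
  then show ?thesis using le[of i j] le[of j i] assms(3) by (cases i j rule: linorder_cases) auto
qed

text \<open>Either \<open>\<tau>\<close> is comparable to the trace \<open>t\<close> and its linear
  decay wins, or some off-diagonal entry is, and the surplus \<open>e\<close> in the logarithmic
  growth of the penalty wins.\<close>

lemma superlevel_trace_bounded:
  fixes S :: "real^('p::{finite,linorder})^('p::{finite,linorder})"
  assumes S: "pos_semidef S" "\<And>i. 0 < S $ i $ i"
    and pen: "offdiag_penalty pen"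
    and liminf: "ereal (real (dim (null_space S))) < Liminf at_infinity (\<lambda>x. ereal (pen x / ln \<bar>x\<bar>))"
  obtains T where "\<And>\<Theta>. pos_def \<Theta> \<Longrightarrow> a \<le> l_Pen (\<lambda>_. 0) pen S \<Theta> \<Longrightarrow> trace \<Theta> \<le> T"
proof -
  define m where "m = dim (null_space S)"
  define k where "k = CARD('p) - m"
  obtain D where D: "0 < D"
    "\<And>\<Theta>. pos_semidef \<Theta> \<Longrightarrow> det \<Theta> \<le> D * trace (S ** \<Theta>) ^ k * trace \<Theta> ^ m"
    "\<And>\<Theta>. pos_semidef \<Theta> \<Longrightarrow> 0 \<le> trace (S ** \<Theta>)"
    unfolding k_def m_def by (rule det_pos_semidef_bound[OF S(1)]) blast
  obtain e C where eC: "0 < e" "\<And>x. x \<noteq> 0 \<Longrightarrow> (real m + e) * ln \<bar>x\<bar> - C \<le> pen x"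
    using offdiag_penalty_log_lower_bound[OF pen _ liminf] unfolding m_def by auto
  define s where "s = Min (range (\<lambda>i. S $ i $ i))"
  have s: "0 < s" "s \<le> S $ i $ i" for i
    using S(2) by (auto simp: s_def)
  define K where "K = 1 + (\<Sum>i\<in>UNIV. \<Sum>j\<in>UNIV. \<bar>S $ i $ j\<bar>)"
  have K: "1 \<le> K" by (simp add: K_def sum_nonneg)
  \<comment> \<open>Slope 1/2 spends half of \<open>\<tau>\<close> on
    \<open>k * ln (\<tau> + 1)\<close>. Below, slope \<open>s/8\<close> spends half of the
    \<open>s * t / 4\<close> that \<open>\<tau> / 2\<close> provides in the first case.\<close>
  obtain C1 where C1: "\<And>x. 0 < x \<Longrightarrow> real k * ln x \<le> 1/2 * x + C1"
    using ln_le_linear[of "real k" "1/2"] by auto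
  obtain C2 where C2: "\<And>x. 0 < x \<Longrightarrow> real m * ln x \<le> s/8 * x + C2"
    using ln_le_linear[of "real m" "s/8"] s(1) by auto
  \<comment> \<open>Chosen so that \<open>K * (c * t)\<close> is half of \<open>s * t\<close>, which
    contradicts \<open>\<tau> < s * t / 2\<close> when all off-diagonal entries are at most
    \<open>c * t\<close> in absolute value.\<close>
  define c where "c = s / (2 * K)"
  have "0 < c" using s(1) K by (simp add: c_def)
  define E where "E = ln D + C1 + 1/2"
  define F where "F = E + C - (real m + e) * ln c - a"
  show ?thesis
  proof (rule that)
    fix \<Theta> :: "real^('p::{finite,linorder})^('p::{finite,linorder})" assume pd: "pos_def \<Theta>" and la: "a \<le> l_Pen (\<lambda>_. 0) pen S \<Theta>"
    define t where "t = trace \<Theta>"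
    define \<tau> where "\<tau> = trace (S ** \<Theta>)"
    have psd: "pos_semidef \<Theta>" using pd by (rule pos_def_imp_pos_semidef)
    have "0 < t" unfolding t_def trace_def by (intro sum_pos pos_def_diag_pos[OF pd]) auto
    have "0 \<le> \<tau>" unfolding \<tau>_def using D(3)[OF psd] .
    have "det \<Theta> \<le> D * \<tau> ^ k * t ^ m" using D(2)[OF psd] by (simp add: \<tau>_def t_def)
    \<comment> \<open>The shift by 1 keeps the argument of the logarithm positive even if
      \<open>\<tau> = 0\<close>.\<close>
    also have "\<dots> \<le> D * (\<tau> + 1) ^ k * t ^ m"
      using \<open>0 \<le> \<tau>\<close> \<open>0 < t\<close> D(1) by (intro mult_right_mono mult_left_mono power_mono) auto
    finally have "ln (det \<Theta>) \<le> ln (D * (\<tau> + 1) ^ k * t ^ m)"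
      using pos_def_det_pos[OF pd] by simp
    also have "\<dots> = ln D + real k * ln (\<tau> + 1) + real m * ln t"
      using D(1) \<open>0 \<le> \<tau>\<close> \<open>0 < t\<close> by (simp add: ln_mult ln_realpow)
    also have "\<dots> \<le> E + \<tau> / 2 + real m * ln t"
      using C1[of "\<tau> + 1"] \<open>0 \<le> \<tau>\<close> by (simp add: E_def add_divide_distrib)
    finally have upper: "a \<le> E - \<tau> / 2 + real m * ln t - Pen (\<lambda>_. 0) pen \<Theta>"
      using la by (simp add: l_Pen_def \<tau>_def)
    show "trace \<Theta> \<le> max (8 * (E + C2 - a) / s) (exp (F / e))"
    proof (cases "s * t / 2 \<le> \<tau>")
      case True
      then have "a \<le> E + C2 - s * t / 8"
        using upper C2[OF \<open>0 < t\<close>] Pen_nonneg[OF pen, of \<Theta>] by simp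
      then have "t \<le> 8 * (E + C2 - a) / s" using s(1) by (simp add: field_simps)
      then show ?thesis by (simp add: t_def)
    next
      case False
      have "\<exists>i j. i \<noteq> j \<and> c * t < \<bar>\<Theta> $ i $ j\<bar>"
      proof (rule ccontr)
        assume "\<not> (\<exists>i j. i \<noteq> j \<and> c * t < \<bar>\<Theta> $ i $ j\<bar>)"
        then have "s * t - (K - 1) * (c * t) \<le> \<tau>"
          using trace_mult_lower_bound[of s S \<Theta> "c * t"] s(2) pos_semidef_diag_nonneg[OF psd] \<open>0 < c\<close> \<open>0 < t\<close>
          by (force simp: t_def \<tau>_def K_def not_less)
        moreover have "(K - 1) * (c * t) \<le> K * (c * t)"
          using \<open>0 < c\<close> \<open>0 < t\<close> by (intro mult_right_mono) auto
        moreover have "K * (c * t) = s * t / 2" using K by (simp add: c_def)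
        ultimately show False using False by simp
      qed
      then obtain i j where ij: "i \<noteq> j" "c * t < \<bar>\<Theta> $ i $ j\<bar>" by blast
      have "0 < c * t" using \<open>0 < c\<close> \<open>0 < t\<close> by simp
      then have "(real m + e) * ln (c * t) \<le> (real m + e) * ln \<bar>\<Theta> $ i $ j\<bar>"
        using ij(2) eC(1) by (intro mult_left_mono) auto
      also have "\<dots> \<le> pen (\<Theta> $ i $ j) + C" using eC(2)[of "\<Theta> $ i $ j"] ij \<open>0 < c * t\<close> by force
      also have "\<dots> \<le> Pen (\<lambda>_. 0) pen \<Theta> + C"
        using offdiag_penalty_le_Pen[OF pen _ ij(1)] psd by (simp add: pos_semidef_def)
      finally have "(real m + e) * ln c + (real m + e) * ln t \<le> Pen (\<lambda>_. 0) pen \<Theta> + C"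
        using \<open>0 < c\<close> \<open>0 < t\<close> by (simp add: ln_mult algebra_simps)
      \<comment> \<open>The terms \<open>m * ln t\<close> cancel and only the surplus
        \<open>e * ln t\<close> remains; \<open>F\<close> collects the constants.\<close>
      then have "e * ln t \<le> F" using upper \<open>0 \<le> \<tau>\<close> by (simp add: F_def algebra_simps)
      then have "ln t \<le> F / e" using eC(1) by (simp add: field_simps)
      then have "t \<le> exp (F / e)" using \<open>0 < t\<close> by (metis exp_le_cancel_iff exp_ln)
      then show ?thesis by (simp add: t_def)
    qed
  qed
qed

section \<open>Compactness and attainment of the maximum\<close>

lemma closed_pos_semidef: "closed {A :: real^'n^'n. pos_semidef A}"
proof -
  have "{A :: real^'n^'n. pos_semidef A} = {A. (\<forall>i j. A $ i $ j = A $ j $ i) \<and> (\<forall>x. 0 \<le> x \<bullet> (A *v x))}"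
    by (auto simp: pos_semidef_def symmetric_matrix_def transpose_def vec_eq_iff)
  also have "closed \<dots>"
    unfolding inner_vec_def matrix_vector_mult_def
    by (intro closed_Collect_conj closed_Collect_all closed_Collect_eq closed_Collect_le continuous_intros)
  finally show ?thesis .
qed

lemma continuous_on_trace [continuous_intros]:
  fixes f :: "'a::topological_space \<Rightarrow> real^'n^'n"
  assumes "continuous_on A f"
  shows "continuous_on A (\<lambda>x. trace (f x))"
  unfolding trace_def by (intro continuous_intros assms)

text \<open>The trace bounds every entry of a positive semidefinite matrix, which gives
  boundedness.\<close>

lemma compact_pos_semidef_trace_le: "compact {A :: real^'n^'n. pos_semidef A \<and> trace A \<le> T}"
proof -
  have "norm A \<le> (\<Sum>i\<in>(UNIV :: 'n set). \<Sum>j\<in>(UNIV :: 'n set). T)"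
    if A: "pos_semidef A" "trace A \<le> T" for A :: "real^'n^'n"
  proof -
    have "norm A \<le> (\<Sum>i\<in>UNIV. norm (A $ i))"
      unfolding norm_vec_def by (rule L2_set_le_sum) simp
    also have "\<dots> \<le> (\<Sum>i\<in>UNIV. \<Sum>j\<in>UNIV. \<bar>A $ i $ j\<bar>)"
      by (intro sum_mono norm_le_l1_cart)
    also have "\<dots> \<le> (\<Sum>i\<in>(UNIV :: 'n set). \<Sum>j\<in>(UNIV :: 'n set). T)"
      by (intro sum_mono order_trans[OF pos_semidef_entry_le_trace[OF A(1)] A(2)])
    finally show ?thesis .
  qed
  then have "bounded {A :: real^'n^'n. pos_semidef A \<and> trace A \<le> T}"
    by (intro boundedI) auto
  moreover have "closed {A :: real^'n^'n. pos_semidef A \<and> trace A \<le> T}"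
    by (intro closed_Collect_conj closed_pos_semidef closed_Collect_le continuous_intros)
  ultimately show ?thesis by (simp add: compact_eq_bounded_closed)
qed

lemma continuous_on_l_Pen:
  assumes "continuous_on UNIV pen" "\<And>\<Theta>. \<Theta> \<in> A \<Longrightarrow> det \<Theta> \<noteq> 0"
  shows "continuous_on A (l_Pen (\<lambda>_. 0) pen S)"
proof -
  have "continuous_on A (\<lambda>\<Theta>. pen (\<Theta> $ i $ j))" for i j
    by (rule continuous_on_compose2[OF assms(1)]) (auto intro!: continuous_intros)
  then show ?thesis
    unfolding l_Pen_def[abs_def] Pen_def split_def trace_def matrix_matrix_mult_def using assms(2)
    by (auto intro!: continuous_intros)
qed

lemma penalised_estimate_exists_if_diag_pos:
  fixes S :: "real^('p::{finite,linorder})^('p::{finite,linorder})"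
  assumes S: "pos_semidef S" "\<And>i. 0 < S $ i $ i"
    and pen: "offdiag_penalty pen"
    and liminf: "ereal (real (dim (null_space S))) < Liminf at_infinity (\<lambda>x. ereal (pen x / ln \<bar>x\<bar>))"
  shows "penalised_estimate_exists (\<lambda>_. 0) pen S"
proof -
  let ?l = "l_Pen (\<lambda>_. 0) pen S"
  define a where "a = ?l (mat 1)"
  obtain T where T: "\<And>\<Theta>. pos_def \<Theta> \<Longrightarrow> a \<le> ?l \<Theta> \<Longrightarrow> trace \<Theta> \<le> T"
    by (rule superlevel_trace_bounded[OF S pen liminf]) blast
  \<comment> \<open>The lower bound on the determinant keeps \<open>K\<close> away from singular
    matrices, so \<open>K\<close> is compact and the likelihood is continuous on it.\<close>
  define K where "K = {\<Theta> :: real^('p::{finite,linorder})^('p::{finite,linorder}). pos_semidef \<Theta> \<and> trace \<Theta> \<le> T} \<inter> {\<Theta>. exp a \<le> det \<Theta>}"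
  have superlevel: "\<Theta> \<in> K" if "pos_def \<Theta>" "a \<le> ?l \<Theta>" for \<Theta>
  proof -
    have psd: "pos_semidef \<Theta>" using that(1) by (rule pos_def_imp_pos_semidef)
    have "0 \<le> trace (S ** \<Theta>)"
      using det_pos_semidef_bound[OF S(1)] psd by metis
    then have "a \<le> ln (det \<Theta>)"
      using that(2) Pen_nonneg[OF pen, of \<Theta>] by (simp add: l_Pen_def)
    then have "exp a \<le> det \<Theta>" using pos_def_det_pos[OF that(1)] by (metis exp_le_cancel_iff exp_ln)
    then show ?thesis using T[OF that] psd by (simp add: K_def)
  qed
  have K_pd: "pos_def \<Theta>" if "\<Theta> \<in> K" for \<Theta>
  proof (rule pos_semidef_det_nonzero_imp_pos_def)
    show "pos_semidef \<Theta>" using that by (simp add: K_def)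
    have "0 < det \<Theta>" using that less_le_trans[OF exp_gt_zero[of a]] by (auto simp: K_def)
    then show "det \<Theta> \<noteq> 0" by simp
  qed
  have "compact K"
    unfolding K_def
    by (intro compact_Int_closed compact_pos_semidef_trace_le closed_Collect_le continuous_intros)
  moreover have "mat 1 \<in> K" using superlevel[OF pos_def_mat_1] by (simp add: a_def)
  moreover have "continuous_on K ?l"
    using pen K_pd pos_def_det_nonzero by (intro continuous_on_l_Pen) (auto simp: offdiag_penalty_def)
  ultimately obtain \<Theta>\<^sub>0 where \<Theta>\<^sub>0: "\<Theta>\<^sub>0 \<in> K" "\<And>\<Theta>. \<Theta> \<in> K \<Longrightarrow> ?l \<Theta> \<le> ?l \<Theta>\<^sub>0"
    using continuous_attains_sup[of K ?l] by blast
  \<comment> \<open>Matrices below level \<open>a\<close> cannot beat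
    \<open>\<Theta>\<^sub>0\<close>, since \<open>mat 1\<close> lies in \<open>K\<close> and has
    value \<open>a\<close>.\<close>
  have max: "?l \<Theta> \<le> ?l \<Theta>\<^sub>0" if "pos_def \<Theta>" for \<Theta>
  proof (cases "a \<le> ?l \<Theta>")
    case True
    then show ?thesis using superlevel that \<Theta>\<^sub>0(2) by blast
  next
    case False
    then show ?thesis using \<Theta>\<^sub>0(2)[OF \<open>mat 1 \<in> K\<close>] by (simp add: a_def)
  qed
  have "?l \<Theta>\<^sub>0 = (SUP \<Theta>\<in>{\<Theta>. pos_def \<Theta>}. ?l \<Theta>)"
    by (rule cSup_eq_maximum[symmetric]) (use max K_pd[OF \<Theta>\<^sub>0(1)] in auto)
  moreover have "bdd_above (?l ` {\<Theta>. pos_def \<Theta>})"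
    using max by (intro bdd_aboveI2) simp
  ultimately show ?thesis
    using K_pd[OF \<Theta>\<^sub>0(1)] by (auto simp: penalised_estimate_exists_def)
qed

section \<open>Unboundedness when a diagonal entry vanishes\<close>

text \<open>Along the diagonal matrices with entry \<open>t\<close> at position \<open>i\<close> and
  1 elsewhere, the determinant is \<open>t\<close>, while the trace term ignores \<open>t\<close>
  because \<open>S $ i $ i = 0\<close> and the penalty sees only zeros.\<close>

lemma l_Pen_not_bdd_above_if_diag_zero:
  fixes S :: "real^('p::{finite,linorder})^('p::{finite,linorder})"
  assumes "S $ i $ i = 0"
  shows "\<not> bdd_above (l_Pen (\<lambda>_. 0) pen S ` {\<Theta>. pos_def \<Theta>})"
proof
  assume "bdd_above (l_Pen (\<lambda>_. 0) pen S ` {\<Theta>. pos_def \<Theta>})"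
  then obtain M where M: "\<And>\<Theta>. pos_def \<Theta> \<Longrightarrow> l_Pen (\<lambda>_. 0) pen S \<Theta> \<le> M"
    by (auto simp: bdd_above_def)
  define d where "d t j = (if j = i then t else 1)" for t :: real and j
  define \<Delta> :: "real \<Rightarrow> real^('p::{finite,linorder})^('p::{finite,linorder})" where
    "\<Delta> t = (\<chi> j k. if j = k then d t j else 0)" for t
  have pd: "pos_def (\<Delta> t)" if "0 < t" for t
    unfolding pos_def_def
  proof (intro conjI allI impI)
    show "symmetric_matrix (\<Delta> t)"
      by (auto simp: symmetric_matrix_def \<Delta>_def transpose_def vec_eq_iff)
    fix x :: "real^('p::{finite,linorder})" assume "x \<noteq> 0"
    then obtain j where "x $ j \<noteq> 0" by (auto simp: vec_eq_iff)
    have "(\<Delta> t *v x) $ j = d t j * x $ j" for j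
    proof -
      have "(\<Delta> t *v x) $ j = (\<Sum>k\<in>UNIV. if j = k then d t j * x $ k else 0)"
        unfolding matrix_vector_mult_def \<Delta>_def vec_lambda_beta by (rule sum.cong) auto
      then show ?thesis by simp
    qed
    then have form: "x \<bullet> (\<Delta> t *v x) = (\<Sum>j\<in>UNIV. d t j * (x $ j)\<^sup>2)"
      by (simp add: inner_vec_def power2_eq_square mult_ac)
    have "0 < d t j * (x $ j)\<^sup>2" using \<open>x $ j \<noteq> 0\<close> \<open>0 < t\<close> by (simp add: d_def)
    then show "0 < x \<bullet> (\<Delta> t *v x)"
      unfolding form using \<open>0 < t\<close> by (intro sum_pos2[of _ j]) (auto simp: d_def)
  qed
  have det: "det (\<Delta> t) = t" for t
    by (subst det_diagonal) (auto simp: \<Delta>_def d_def)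
  have tr: "trace (S ** \<Delta> t) = (\<Sum>j\<in>UNIV. S $ j $ j)" for t
  proof -
    have "trace (S ** \<Delta> t) = (\<Sum>j\<in>UNIV. S $ j $ j * d t j)"
      by (simp add: trace_def matrix_matrix_mult_def \<Delta>_def if_distrib cong: if_cong)
    also have "\<dots> = (\<Sum>j\<in>UNIV. S $ j $ j)"
      by (rule sum.cong) (use assms in \<open>auto simp: d_def\<close>)
    finally show ?thesis .
  qed
  have Pen: "Pen (\<lambda>_. 0) pen (\<Delta> t) = Pen (\<lambda>_. 0) pen (\<Delta> 1)" for t
    unfolding Pen_def by (simp, rule sum.cong) (auto simp: \<Delta>_def)
  define b where "b = (\<Sum>j\<in>UNIV. S $ j $ j) + Pen (\<lambda>_. 0) pen (\<Delta> 1)"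
  \<comment> \<open>The likelihood along the family is \<open>ln t - b\<close>, so this
    \<open>t\<close> exceeds the supposed bound \<open>M\<close> by 1.\<close>
  have "l_Pen (\<lambda>_. 0) pen S (\<Delta> (exp (M + b + 1))) = M + 1"
    unfolding l_Pen_def det tr Pen[of "exp (M + b + 1)"] by (simp add: b_def)
  then show False using M[OF pd, of "exp (M + b + 1)"] by simp
qed

theorem proposition6:
  fixes S :: "real^('p::{finite,linorder})^('p::{finite,linorder})"
    and pen :: "real \<Rightarrow> real"
    and m\<^sub>0 :: nat
  assumes "pos_semidef S"
    and "dim (null_space S) = m\<^sub>0"
    and "offdiag_penalty pen"
    and "Liminf at_infinity (\<lambda>x. ereal (pen x / ln \<bar>x\<bar>)) > ereal (real m\<^sub>0)"
  shows "penalised_estimate_exists (\<lambda>_. 0) pen S \<longleftrightarrow> (\<forall>i. S $ i $ i > 0)"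
proof
  assume "penalised_estimate_exists (\<lambda>_. 0) pen S"
  then have "S $ i $ i \<noteq> 0" for i
    using l_Pen_not_bdd_above_if_diag_zero[of S i pen] by (auto simp: penalised_estimate_exists_def)
  then show "\<forall>i. S $ i $ i > 0"
    using pos_semidef_diag_nonneg[OF assms(1)] by (simp add: order_less_le)
next
  assume "\<forall>i. S $ i $ i > 0"
  then show "penalised_estimate_exists (\<lambda>_. 0) pen S"
    using penalised_estimate_exists_if_diag_pos assms by blast
qed

end
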